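(* Let $n\in\mathbb N$, let $\sigma(x_1,\dots,x_k)$ be a bounded-quantifier formula of set theory and let $\xi_1,\dots,\xi_k\in\mathbb V_n$. Then $\sigma(\xi_1,\dots,\xi_k)\iff\sigma(\mathfrak i_n(\xi_1),\dots,\mathfrak i_n(\xi_k))$.
   Context: Let $\mathbf X$ be a set of atoms with $\mathbb R\subseteq\mathbf X$, and $\mathbb V=\bigcup_{k\ge0}V_k(\mathbf X)$ the superstructure over $\mathbf X$ ($V_0(\mathbf X)=\mathbf X$, $V_{k+1}(\mathbf X)=V_k(\mathbf X)\cup\mathcal P(V_k(\mathbf X))$). Fix a star map $*:\mathbb V\to\mathbb V$, also written $\mathfrak s$ (${}^*A=\mathfrak s(A)$), such that ${}^*\mathbf X=\mathbf X$, ${}^*r=r$ for all $r\in\mathbb R$, ${}^*\mathbb N\ne\mathbb N$, and transfer holds for bounded-quantifier formulas: $\varphi(A_1,\dots,A_k)\iff\varphi({}^*A_1,\dots,{}^*A_k)$ for $A_i\in\mathbb V$. $\mathfrak s^n$ is the $n$-fold iterate. $\mathbb V_n=\bigcup_{X\in\mathbb V}\mathfrak s^n(X)$. For $X\in\mathbb V$, $\mathfrak s\upharpoonright X\in\mathbb V$, and the $n$-th internal star map is $\mathfrak i_n=\bigcup_{X\in\mathbb V}\mathfrak s^n(\mathfrak s\upharpoonright X):\mathbb V_n\to\mathbb V_{n+1}$ (a well-defined function). *)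

theory Defs
  imports Complex_Main
begin

text \<open>
  A superstructure over an infinite set is larger than every iterated power set of that set, so HOL
  cannot build it as a type from the type of its atoms. It is therefore given as a type
  \<open>'v\<close> all of whose elements are the atoms and sets of the superstructure, together with its
  membership relation \<open>E\<close> (read \<open>E x a\<close> as ``x is an element of a'') and the set \<open>X\<close> of atoms;
  the locale \<open>superstructure\<close> below determines this data up to isomorphism from \<open>X\<close>.
\<close>

definition elts :: "('v \<Rightarrow> 'v \<Rightarrow> bool) \<Rightarrow> 'v \<Rightarrow> 'v set" where
  "elts E a = {x. E x a}"

text \<open>
  The elements outside \<open>X\<close> are the sets, so the second summand of \<open>vlevel E X (Suc k)\<close>
  is the power set of \<open>vlevel E X k\<close>.
\<close>

primrec vlevel :: "('v \<Rightarrow> 'v \<Rightarrow> bool) \<Rightarrow> 'v set \<Rightarrow> nat \<Rightarrow> 'v set" where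
  "vlevel E X 0 = X"
| "vlevel E X (Suc k) = vlevel E X k \<union> {a. a \<notin> X \<and> elts E a \<subseteq> vlevel E X k}"

locale superstructure =
  fixes E :: "'v \<Rightarrow> 'v \<Rightarrow> bool" and X :: "'v set"
  assumes atoms: "a \<in> X \<Longrightarrow> elts E a = {}"
    and extensionality: "a \<notin> X \<Longrightarrow> b \<notin> X \<Longrightarrow> elts E a = elts E b \<Longrightarrow> a = b"
    and all_subsets: "S \<subseteq> vlevel E X k \<Longrightarrow> \<exists>a. a \<notin> X \<and> elts E a = S"
    and exhausted: "(\<Union>k. vlevel E X k) = UNIV"

text \<open>The set of the superstructure with a given collection of elements.\<close>

definition mkset :: "('v \<Rightarrow> 'v \<Rightarrow> bool) \<Rightarrow> 'v set \<Rightarrow> 'v set \<Rightarrow> 'v" where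
  "mkset E X S = (THE a. a \<notin> X \<and> elts E a = S)"

definition kpair :: "('v \<Rightarrow> 'v \<Rightarrow> bool) \<Rightarrow> 'v set \<Rightarrow> 'v \<Rightarrow> 'v \<Rightarrow> 'v" where
  "kpair E X a b = mkset E X {mkset E X {a}, mkset E X {a, b}}"

text \<open>
  Bounded-quantifier formulas in the language of membership and equality; variables are numbered.
  \<open>FBAll i j \<phi>\<close> and \<open>FBEx i j \<phi>\<close> quantify the variable \<open>i\<close> over the elements of the variable
  \<open>j\<close>; the bound \<open>j\<close> is read outside the scope of the quantifier (this matters only if \<open>i = j\<close>).
\<close>

datatype bformula =
    FEq nat nat
  | FMem nat nat
  | FNot bformula
  | FAnd bformula bformula
  | FOr bformula bformula
  | FImp bformula bformula
  | FIff bformula bformula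
  | FBAll nat nat bformula
  | FBEx nat nat bformula

primrec free_vars :: "bformula \<Rightarrow> nat set" where
  "free_vars (FEq i j) = {i, j}"
| "free_vars (FMem i j) = {i, j}"
| "free_vars (FNot \<phi>) = free_vars \<phi>"
| "free_vars (FAnd \<phi> \<psi>) = free_vars \<phi> \<union> free_vars \<psi>"
| "free_vars (FOr \<phi> \<psi>) = free_vars \<phi> \<union> free_vars \<psi>"
| "free_vars (FImp \<phi> \<psi>) = free_vars \<phi> \<union> free_vars \<psi>"
| "free_vars (FIff \<phi> \<psi>) = free_vars \<phi> \<union> free_vars \<psi>"
| "free_vars (FBAll i j \<phi>) = insert j (free_vars \<phi> - {i})"
| "free_vars (FBEx i j \<phi>) = insert j (free_vars \<phi> - {i})"

primrec sat :: "('v \<Rightarrow> 'v \<Rightarrow> bool) \<Rightarrow> bformula \<Rightarrow> (nat \<Rightarrow> 'v) \<Rightarrow> bool" where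
  "sat E (FEq i j) A \<longleftrightarrow> A i = A j"
| "sat E (FMem i j) A \<longleftrightarrow> E (A i) (A j)"
| "sat E (FNot \<phi>) A \<longleftrightarrow> \<not> sat E \<phi> A"
| "sat E (FAnd \<phi> \<psi>) A \<longleftrightarrow> sat E \<phi> A \<and> sat E \<psi> A"
| "sat E (FOr \<phi> \<psi>) A \<longleftrightarrow> sat E \<phi> A \<or> sat E \<psi> A"
| "sat E (FImp \<phi> \<psi>) A \<longleftrightarrow> (sat E \<phi> A \<longrightarrow> sat E \<psi> A)"
| "sat E (FIff \<phi> \<psi>) A \<longleftrightarrow> (sat E \<phi> A \<longleftrightarrow> sat E \<psi> A)"
| "sat E (FBAll i j \<phi>) A \<longleftrightarrow> (\<forall>a \<in> elts E (A j). sat E \<phi> (A(i := a)))"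
| "sat E (FBEx i j \<phi>) A \<longleftrightarrow> (\<exists>a \<in> elts E (A j). sat E \<phi> (A(i := a)))"

text \<open>
  The injection \<open>rl\<close> expresses that the real numbers are among the atoms. In the
  transfer axiom only the values of \<open>A\<close> at the finitely many free variables of \<open>\<phi>\<close> matter.
\<close>

locale star_superstructure = superstructure E X
  for E :: "'v \<Rightarrow> 'v \<Rightarrow> bool" and X :: "'v set" +
  fixes rl :: "real \<Rightarrow> 'v" and star :: "'v \<Rightarrow> 'v"
  assumes reals_inj: "inj rl"
    and reals_atoms: "range rl \<subseteq> X"
    and star_atoms: "star (mkset E X X) = mkset E X X"
    and star_real: "star (rl r) = rl r"
    and star_nat: "star (mkset E X (rl ` \<nat>)) \<noteq> mkset E X (rl ` \<nat>)"
    and transfer: "sat E \<phi> A \<longleftrightarrow> sat E \<phi> (\<lambda>i. star (A i))"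

definition iter_univ :: "('v \<Rightarrow> 'v \<Rightarrow> bool) \<Rightarrow> ('v \<Rightarrow> 'v) \<Rightarrow> nat \<Rightarrow> 'v set" where
  "iter_univ E star n = (\<Union>B. elts E ((star ^^ n) B))"

text \<open>The restriction of the star map to \<open>B\<close>, as a set of ordered pairs in the superstructure.\<close>

definition star_restrict ::
    "('v \<Rightarrow> 'v \<Rightarrow> bool) \<Rightarrow> 'v set \<Rightarrow> ('v \<Rightarrow> 'v) \<Rightarrow> 'v \<Rightarrow> 'v" where
  "star_restrict E X star B = mkset E X ((\<lambda>x. kpair E X x (star x)) ` elts E B)"

definition internal_star_graph ::
    "('v \<Rightarrow> 'v \<Rightarrow> bool) \<Rightarrow> 'v set \<Rightarrow> ('v \<Rightarrow> 'v) \<Rightarrow> nat \<Rightarrow> 'v set" where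
  "internal_star_graph E X star n = (\<Union>B. elts E ((star ^^ n) (star_restrict E X star B)))"

definition internal_star ::
    "('v \<Rightarrow> 'v \<Rightarrow> bool) \<Rightarrow> 'v set \<Rightarrow> ('v \<Rightarrow> 'v) \<Rightarrow> nat \<Rightarrow> 'v \<Rightarrow> 'v" where
  "internal_star E X star n \<xi> = (THE \<eta>. kpair E X \<xi> \<eta> \<in> internal_star_graph E X star n)"

end

theory Submission
  imports Defs
begin

text \<open>
  Let \<open>F\<close> be the restriction of the star map to a set \<open>B\<close>. By transfer, pairs
  \<open>(x\<^sub>1, y\<^sub>1), \<dots>, (x\<^sub>k, y\<^sub>k) \<in> F\<close> always satisfy \<open>\<sigma>(x\<^sub>1, \<dots>, x\<^sub>k) \<longleftrightarrow> \<sigma>(y\<^sub>1, \<dots>, y\<^sub>k)\<close>. With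
  \<open>\<sigma>\<close> fixed, this is itself a bounded-quantifier statement about \<open>F\<close>, so \<open>n\<close> further
  applications of transfer give it for the \<open>n\<close>-fold star of \<open>F\<close>. The formula \<open>x\<^sub>1 = x\<^sub>2\<close> as
  \<open>\<sigma>\<close> shows that the \<open>n\<close>-th internal star map is single-valued.
\<close>

section \<open>Coincidence and renaming of variables in bounded formulas\<close>

lemma sat_cong_free_vars:
  "(\<And>i. i \<in> free_vars \<phi> \<Longrightarrow> A i = A' i) \<Longrightarrow> sat E \<phi> A \<longleftrightarrow> sat E \<phi> A'"
proof (induction \<phi> arbitrary: A A')
  case (FBAll i j \<phi>)
  have "sat E \<phi> (A(i := a)) \<longleftrightarrow> sat E \<phi> (A'(i := a))" for a
    by (rule FBAll.IH) (use FBAll.prems in auto)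
  moreover have "A j = A' j" using FBAll.prems by simp
  ultimately show ?case by simp
next
  case (FBEx i j \<phi>)
  have "sat E \<phi> (A(i := a)) \<longleftrightarrow> sat E \<phi> (A'(i := a))" for a
    by (rule FBEx.IH) (use FBEx.prems in auto)
  moreover have "A j = A' j" using FBEx.prems by simp
  ultimately show ?case by simp
next
  case (FNot \<phi>)
  then show ?case by (metis free_vars.simps(3) sat.simps(3))
next
  case (FAnd \<phi> \<psi>)
  have "sat E \<phi> A \<longleftrightarrow> sat E \<phi> A'" "sat E \<psi> A \<longleftrightarrow> sat E \<psi> A'"
    using FAnd.prems by (auto intro!: FAnd.IH)
  then show ?case by simp
next
  case (FOr \<phi> \<psi>)
  have "sat E \<phi> A \<longleftrightarrow> sat E \<phi> A'" "sat E \<psi> A \<longleftrightarrow> sat E \<psi> A'"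
    using FOr.prems by (auto intro!: FOr.IH)
  then show ?case by simp
next
  case (FImp \<phi> \<psi>)
  have "sat E \<phi> A \<longleftrightarrow> sat E \<phi> A'" "sat E \<psi> A \<longleftrightarrow> sat E \<psi> A'"
    using FImp.prems by (auto intro!: FImp.IH)
  then show ?case by simp
next
  case (FIff \<phi> \<psi>)
  have "sat E \<phi> A \<longleftrightarrow> sat E \<phi> A'" "sat E \<psi> A \<longleftrightarrow> sat E \<psi> A'"
    using FIff.prems by (auto intro!: FIff.IH)
  then show ?case by simp
qed simp_all

text \<open>Bound variables are renamed too; an injective \<open>f\<close> keeps this free of
  capture.\<close>

primrec rename :: "(nat \<Rightarrow> nat) \<Rightarrow> bformula \<Rightarrow> bformula" where
  "rename f (FEq i j) = FEq (f i) (f j)"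
| "rename f (FMem i j) = FMem (f i) (f j)"
| "rename f (FNot \<phi>) = FNot (rename f \<phi>)"
| "rename f (FAnd \<phi> \<psi>) = FAnd (rename f \<phi>) (rename f \<psi>)"
| "rename f (FOr \<phi> \<psi>) = FOr (rename f \<phi>) (rename f \<psi>)"
| "rename f (FImp \<phi> \<psi>) = FImp (rename f \<phi>) (rename f \<psi>)"
| "rename f (FIff \<phi> \<psi>) = FIff (rename f \<phi>) (rename f \<psi>)"
| "rename f (FBAll i j \<phi>) = FBAll (f i) (f j) (rename f \<phi>)"
| "rename f (FBEx i j \<phi>) = FBEx (f i) (f j) (rename f \<phi>)"

lemma sat_rename:
  assumes "inj f"
  shows "sat E (rename f \<phi>) A \<longleftrightarrow> sat E \<phi> (\<lambda>i. A (f i))"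
proof -
  have upd: "(\<lambda>l. (A(f i := a)) (f l)) = (\<lambda>l. A (f l))(i := a)" for A :: "nat \<Rightarrow> 'a" and i a
    using assms by (auto simp: fun_eq_iff inj_def)
  show ?thesis
    by (induction \<phi> arbitrary: A) (simp_all only: rename.simps sat.simps upd)
qed

section \<open>Levels, sets and ordered pairs in the superstructure\<close>

context superstructure
begin

lemma vlevel_mono: "i \<le> j \<Longrightarrow> vlevel E X i \<subseteq> vlevel E X j"
  by (rule lift_Suc_mono_le) auto

lemma elts_subset_vlevel: "a \<in> vlevel E X k \<Longrightarrow> elts E a \<subseteq> vlevel E X k"
  by (induction k) (auto simp: atoms)

lemma obtain_elts_subset_vlevel: obtains k where "elts E a \<subseteq> vlevel E X k"
  using exhausted elts_subset_vlevel by blast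

text \<open>Nonemptiness rules out atoms, which have no elements either and so look like the empty
  set.\<close>

lemma elts_eq_imp_eq: "elts E a = elts E b \<Longrightarrow> elts E a \<noteq> {} \<Longrightarrow> a = b"
  by (metis atoms extensionality)

lemma mkset:
  assumes "S \<subseteq> vlevel E X k"
  shows "mkset E X S \<notin> X" and "elts E (mkset E X S) = S"
proof -
  have "\<exists>!a. a \<notin> X \<and> elts E a = S"
    using all_subsets[OF assms] extensionality by blast
  from theI'[OF this] show "mkset E X S \<notin> X" "elts E (mkset E X S) = S"
    by (simp_all add: mkset_def)
qed

lemma mkset_in_vlevel: "S \<subseteq> vlevel E X k \<Longrightarrow> mkset E X S \<in> vlevel E X (Suc k)"
  by (simp add: mkset)

lemma obtain_pair_vlevel: obtains k where "a \<in> vlevel E X k" "b \<in> vlevel E X k"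
proof -
  obtain i j where "a \<in> vlevel E X i" "b \<in> vlevel E X j"
    using exhausted by blast
  then show thesis
    using that[of "max i j"] vlevel_mono[of i "max i j"] vlevel_mono[of j "max i j"] by auto
qed

lemma elts_mkset_pair [simp]: "elts E (mkset E X {a, b}) = {a, b}"
proof -
  obtain k where "a \<in> vlevel E X k" "b \<in> vlevel E X k" by (rule obtain_pair_vlevel)
  then show ?thesis by (intro mkset(2)[of _ k]) simp
qed

lemma elts_mkset_singleton [simp]: "elts E (mkset E X {a}) = {a}"
  using elts_mkset_pair[of a a] by simp

lemma elts_kpair [simp]: "elts E (kpair E X a b) = {mkset E X {a}, mkset E X {a, b}}"
  by (simp add: kpair_def)

lemma mkset_pair_eq_iff: "mkset E X {a, b} = mkset E X {c, d} \<longleftrightarrow> {a, b} = {c, d}"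
  by (metis elts_mkset_pair)

lemma kpair_eq_iff: "kpair E X a b = kpair E X c d \<longleftrightarrow> a = c \<and> b = d"
proof
  assume "kpair E X a b = kpair E X c d"
  then have "{mkset E X {a, a}, mkset E X {a, b}} = {mkset E X {c, c}, mkset E X {c, d}}"
    using elts_kpair by (metis insert_absorb2)
  then show "a = c \<and> b = d"
    by (simp only: doubleton_eq_iff mkset_pair_eq_iff) auto
qed simp

text \<open>One step up is for the two inner sets, one for the pair; a graph over a single level is
  thus a set of the superstructure.\<close>

lemma kpair_in_vlevel:
  assumes "a \<in> vlevel E X k" "b \<in> vlevel E X k"
  shows "kpair E X a b \<in> vlevel E X (Suc (Suc k))"
  unfolding kpair_def using assms by (intro mkset_in_vlevel) (simp add: mkset_in_vlevel mkset)

section \<open>Bounded formulas about ordered pairs\<close>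

text \<open>The right-hand side quantifies only over \<open>p\<close> and elements of
  \<open>p\<close> once the conditions on \<open>elts\<close> are spelled out, so it can be written
  as a bounded formula.\<close>

lemma eq_kpair_iff:
  "p = kpair E X x y \<longleftrightarrow>
    (\<exists>a\<in>elts E p. \<exists>b\<in>elts E p.
      elts E a = {x} \<and> elts E b = {x, y} \<and> (\<forall>c\<in>elts E p. c = a \<or> c = b))"
    (is "_ \<longleftrightarrow> ?R")
proof
  assume "p = kpair E X x y"
  then show ?R by simp
next
  assume ?R
  then obtain a b where ab: "elts E a = {x}" "elts E b = {x, y}" "elts E p = {a, b}" by blast
  then have "a = mkset E X {x}" "b = mkset E X {x, y}" by (auto intro!: elts_eq_imp_eq)
  with ab(3) show "p = kpair E X x y" by (intro elts_eq_imp_eq) auto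
qed

text \<open>
  Variables 3, 4, 5 serve as bound variables, so \<open>p\<close>, \<open>x\<close>, \<open>y\<close> have to avoid them.
\<close>

definition pair_formula :: "nat \<Rightarrow> nat \<Rightarrow> nat \<Rightarrow> bformula" where
  "pair_formula p x y =
    FBEx 3 p (FBEx 4 p (FAnd (FAnd (FMem x 3) (FBAll 5 3 (FEq 5 x)))
      (FAnd (FAnd (FMem x 4) (FAnd (FMem y 4) (FBAll 5 4 (FOr (FEq 5 x) (FEq 5 y)))))
        (FBAll 5 p (FOr (FEq 5 3) (FEq 5 4))))))"

lemma sat_pair_formula:
  assumes "p \<notin> {3, 4, 5}" "x \<notin> {3, 4, 5}" "y \<notin> {3, 4, 5}"
  shows "sat E (pair_formula p x y) A \<longleftrightarrow> A p = kpair E X (A x) (A y)"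
proof -
  have "E u a \<and> (\<forall>z\<in>elts E a. z = u) \<longleftrightarrow> elts E a = {u}" for a u
    by (auto simp: elts_def)
  moreover have
    "E u b \<and> E v b \<and> (\<forall>z\<in>elts E b. z = u \<or> z = v) \<longleftrightarrow> elts E b = {u, v}" for b u v
    by (auto simp: elts_def)
  ultimately show ?thesis
    using assms by (simp add: pair_formula_def eq_kpair_iff)
qed

text \<open>
  For \<open>F\<close> the value of variable 0: all pairs \<open>(x\<^sub>1, y\<^sub>1), \<dots>, (x\<^sub>k, y\<^sub>k)\<close> in \<open>F\<close> satisfy \<open>\<psi>\<close>,
  where \<open>x\<^sub>i\<close> and \<open>y\<^sub>i\<close> are the variables \<open>8 + 2 * i\<close> and \<open>9 + 2 * i\<close>. As the coordinates of a
  Kuratowski pair \<open>p\<close> lie in an element of \<open>p\<close>, the quantifiers are bounded.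
\<close>

primrec all_pairs :: "nat \<Rightarrow> bformula \<Rightarrow> bformula" where
  "all_pairs 0 \<psi> = \<psi>"
| "all_pairs (Suc k) \<psi> =
    FBAll 1 0 (FBAll 2 1 (FBAll (8 + 2 * Suc k) 2 (FBAll (9 + 2 * Suc k) 2
      (FImp (pair_formula 1 (8 + 2 * Suc k) (9 + 2 * Suc k)) (all_pairs k \<psi>)))))"

lemma sat_all_pairs_Suc:
  "sat E (all_pairs (Suc k) \<psi>) A \<longleftrightarrow>
    (\<forall>p\<in>elts E (A 0). \<forall>u\<in>elts E p. \<forall>x\<in>elts E u. \<forall>y\<in>elts E u. p = kpair E X x y \<longrightarrow>
      sat E (all_pairs k \<psi>) (A(1 := p, 2 := u, 8 + 2 * Suc k := x, 9 + 2 * Suc k := y)))"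
  by (simp add: sat_pair_formula)

text \<open>The induction fixes the pair with the highest index first and descends; the clause on
  \<open>i > k\<close> says that later steps leave the pairs already fixed untouched.\<close>

lemma sat_all_pairsD:
  assumes "sat E (all_pairs k \<psi>) A"
    and "\<And>i. i \<in> {1..k} \<Longrightarrow> kpair E X (x i) (y i) \<in> elts E (A 0)"
  shows "\<exists>A'. sat E \<psi> A' \<and> (\<forall>i\<in>{1..k}. A' (8 + 2 * i) = x i \<and> A' (9 + 2 * i) = y i) \<and>
    (\<forall>i>k. A' (8 + 2 * i) = A (8 + 2 * i) \<and> A' (9 + 2 * i) = A (9 + 2 * i))"
  using assms
proof (induction k arbitrary: A)
  case 0
  then show ?case by auto
next
  case (Suc k)
  \<comment> \<open>The element of the Kuratowski pair that contains both coordinates serves as the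
    value of variable 2.\<close>
  define u where "u = mkset E X {x (Suc k), y (Suc k)}"
  define A1 where "A1 = A(1 := kpair E X (x (Suc k)) (y (Suc k)), 2 := u,
    8 + 2 * Suc k := x (Suc k), 9 + 2 * Suc k := y (Suc k))"
  have "kpair E X (x (Suc k)) (y (Suc k)) \<in> elts E (A 0)"
    by (rule Suc.prems) simp
  then have "sat E (all_pairs k \<psi>) A1"
    using Suc.prems(1)[unfolded sat_all_pairs_Suc] unfolding A1_def u_def
    by (elim ballE impE) auto
  moreover have "kpair E X (x i) (y i) \<in> elts E (A1 0)" if "i \<in> {1..k}" for i
    using Suc.prems(2) that by (simp add: A1_def)
  ultimately obtain A' where A': "sat E \<psi> A'"
    "\<forall>i\<in>{1..k}. A' (8 + 2 * i) = x i \<and> A' (9 + 2 * i) = y i"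
    "\<forall>i>k. A' (8 + 2 * i) = A1 (8 + 2 * i) \<and> A' (9 + 2 * i) = A1 (9 + 2 * i)"
    using Suc.IH by blast
  \<comment> \<open>Parity keeps an update of a first coordinate from overwriting a second one, and
    conversely.\<close>
  have odd_even: "8 + 2 * i \<noteq> 9 + 2 * j" for i j :: nat by presburger
  have "A1 (8 + 2 * Suc k) = x (Suc k)" "A1 (9 + 2 * Suc k) = y (Suc k)"
    by (simp_all add: A1_def)
  then have "A' (8 + 2 * i) = x i \<and> A' (9 + 2 * i) = y i" if "i \<in> {1..Suc k}" for i
    using A'(2,3) that by (cases "i = Suc k") auto
  moreover have "A1 (8 + 2 * i) = A (8 + 2 * i) \<and> A1 (9 + 2 * i) = A (9 + 2 * i)"
    if "i > Suc k" for i
    using that odd_even[of i "Suc k"] odd_even[of "Suc k" i] by (auto simp: A1_def)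
  ultimately show ?case using A' by (intro exI[of _ A']) auto
qed

text \<open>Agreement with \<open>A\<close> beyond \<open>k\<close> carries the pairs already chosen
  through the induction.\<close>

lemma sat_all_pairsI:
  assumes "\<And>A'. A' 0 = A 0 \<Longrightarrow>
      (\<And>i. i > k \<Longrightarrow> A' (8 + 2 * i) = A (8 + 2 * i) \<and> A' (9 + 2 * i) = A (9 + 2 * i)) \<Longrightarrow>
      (\<And>i. i \<in> {1..k} \<Longrightarrow> kpair E X (A' (8 + 2 * i)) (A' (9 + 2 * i)) \<in> elts E (A 0)) \<Longrightarrow>
      sat E \<psi> A'"
  shows "sat E (all_pairs k \<psi>) A"
  using assms
proof (induction k arbitrary: A)
  case 0
  then show ?case by auto
next
  case (Suc k)
  have odd_even: "8 + 2 * i \<noteq> 9 + 2 * j" for i j :: nat by presburger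
  show ?case
    unfolding sat_all_pairs_Suc
  proof (intro ballI impI)
    fix p u x y
    assume "p \<in> elts E (A 0)" and "p = kpair E X x y"
    then have xy: "kpair E X x y \<in> elts E (A 0)" by simp
    let ?A1 = "A(1 := p, 2 := u, 8 + 2 * Suc k := x, 9 + 2 * Suc k := y)"
    show "sat E (all_pairs k \<psi>) ?A1"
    proof (rule Suc.IH)
      fix A'
      assume A': "A' 0 = ?A1 0"
        "\<And>i. i > k \<Longrightarrow> A' (8 + 2 * i) = ?A1 (8 + 2 * i) \<and> A' (9 + 2 * i) = ?A1 (9 + 2 * i)"
        "\<And>i. i \<in> {1..k} \<Longrightarrow> kpair E X (A' (8 + 2 * i)) (A' (9 + 2 * i)) \<in> elts E (?A1 0)"
      \<comment> \<open>\<open>Suc k\<close> lies just above \<open>k\<close>, so the agreement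
        recovers the pair chosen last.\<close>
      have last: "A' (8 + 2 * Suc k) = x" "A' (9 + 2 * Suc k) = y"
        using A'(2)[of "Suc k"] by simp_all
      show "sat E \<psi> A'"
      proof (rule Suc.prems)
        show "A' 0 = A 0" using A'(1) by simp
        show "A' (8 + 2 * i) = A (8 + 2 * i) \<and> A' (9 + 2 * i) = A (9 + 2 * i)"
          if "i > Suc k" for i
          using that A'(2)[of i] odd_even[of i "Suc k"] odd_even[of "Suc k" i] by auto
        show "kpair E X (A' (8 + 2 * i)) (A' (9 + 2 * i)) \<in> elts E (A 0)"
          if "i \<in> {1..Suc k}" for i
          using that A'(3)[of i] xy last by (cases "i = Suc k") auto
      qed
    qed
  qed
qed

end

section \<open>Transfer for the iterated star map and its restrictions\<close>

context star_superstructure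
begin

lemma transfer_funpow: "sat E \<phi> A \<longleftrightarrow> sat E \<phi> (\<lambda>i. (star ^^ n) (A i))"
proof (induction n)
  case (Suc n)
  then show ?case using transfer[of \<phi> "\<lambda>i. (star ^^ n) (A i)"] by simp
qed simp

lemma star_mem: "x \<in> elts E B \<Longrightarrow> star x \<in> elts E (star B)"
  using transfer[of "FMem 0 1" "\<lambda>i. if i = 0 then x else B"] by (simp add: elts_def)

text \<open>Inclusion is a bounded formula, so iterated transfer preserves it.\<close>

lemma funpow_star_mono:
  assumes "elts E B \<subseteq> elts E C"
  shows "elts E ((star ^^ n) B) \<subseteq> elts E ((star ^^ n) C)"
  using assms
    transfer_funpow[of "FBAll 2 0 (FMem 2 1)" "\<lambda>i. if i = 0 then B else C" n]
  by (auto simp: elts_def)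

text \<open>Images of elements of \<open>B\<close> lie in \<open>star B\<close>, so all coordinates
  share one level and \<open>mkset\<close> yields a genuine set.\<close>

lemma elts_star_restrict:
  "elts E (star_restrict E X star B) = (\<lambda>x. kpair E X x (star x)) ` elts E B"
proof -
  obtain i j where ij: "elts E B \<subseteq> vlevel E X i" "elts E (star B) \<subseteq> vlevel E X j"
    by (metis obtain_elts_subset_vlevel)
  have "x \<in> vlevel E X (max i j) \<and> star x \<in> vlevel E X (max i j)" if "x \<in> elts E B" for x
    using that star_mem[OF that] ij vlevel_mono[of i "max i j"] vlevel_mono[of j "max i j"]
    by auto
  then have "(\<lambda>x. kpair E X x (star x)) ` elts E B \<subseteq> vlevel E X (Suc (Suc (max i j)))"
    using kpair_in_vlevel by blast
  then show ?thesis unfolding star_restrict_def by (rule mkset(2))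
qed

lemma kpair_in_star_restrict_iff:
  "kpair E X x y \<in> elts E (star_restrict E X star B) \<longleftrightarrow> x \<in> elts E B \<and> y = star x"
  by (auto simp: elts_star_restrict kpair_eq_iff)

lemma star_restrict_mono:
  "elts E B \<subseteq> elts E C \<Longrightarrow>
    elts E (star_restrict E X star B) \<subseteq> elts E (star_restrict E X star C)"
  by (auto simp: elts_star_restrict)

lemma transfer_star_restrict:
  assumes "free_vars \<sigma> \<subseteq> {1..k}"
    and "\<And>i. i \<in> {1..k} \<Longrightarrow>
      kpair E X (x i) (y i) \<in> elts E ((star ^^ n) (star_restrict E X star B))"
  shows "sat E \<sigma> x \<longleftrightarrow> sat E \<sigma> y"
proof -
  define F where "F = star_restrict E X star B"
  \<comment> \<open>The two copies of \<open>\<sigma>\<close> use the even and odd variables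
    quantified by \<open>all_pairs\<close>, clear of the auxiliary variables 0 to 5.\<close>
  define \<psi> where
    "\<psi> = FIff (rename (\<lambda>i. 8 + 2 * i) \<sigma>) (rename (\<lambda>i. 9 + 2 * i) \<sigma>)"
  have \<psi>: "sat E \<psi> A \<longleftrightarrow> (sat E \<sigma> (\<lambda>i. A (8 + 2 * i)) \<longleftrightarrow> sat E \<sigma> (\<lambda>i. A (9 + 2 * i)))" for A
    unfolding \<psi>_def by (simp add: sat_rename inj_def)
  have "sat E (all_pairs k \<psi>) (\<lambda>_. F)"
  proof (rule sat_all_pairsI)
    fix A'
    assume "\<And>i. i \<in> {1..k} \<Longrightarrow> kpair E X (A' (8 + 2 * i)) (A' (9 + 2 * i)) \<in> elts E F"
    \<comment> \<open>A pair in \<open>F\<close> consists of a point and its star, so here the claim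
      is the original transfer.\<close>
    then have "A' (9 + 2 * i) = star (A' (8 + 2 * i))" if "i \<in> free_vars \<sigma>" for i
      using that assms(1) by (auto simp: F_def kpair_in_star_restrict_iff)
    then have "sat E \<sigma> (\<lambda>i. A' (9 + 2 * i)) \<longleftrightarrow> sat E \<sigma> (\<lambda>i. star (A' (8 + 2 * i)))"
      by (rule sat_cong_free_vars)
    then show "sat E \<psi> A'" using transfer[of \<sigma> "\<lambda>i. A' (8 + 2 * i)"] by (simp add: \<psi>)
  qed
  then have "sat E (all_pairs k \<psi>) (\<lambda>_. (star ^^ n) F)"
    by (rule transfer_funpow[THEN iffD1])
  from sat_all_pairsD[OF this, of x y] assms(2) obtain A' where A': "sat E \<psi> A'"
    "\<forall>i\<in>{1..k}. A' (8 + 2 * i) = x i \<and> A' (9 + 2 * i) = y i"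
    unfolding F_def by blast
  have "sat E \<sigma> (\<lambda>i. A' (8 + 2 * i)) \<longleftrightarrow> sat E \<sigma> x" "sat E \<sigma> (\<lambda>i. A' (9 + 2 * i)) \<longleftrightarrow> sat E \<sigma> y"
    using A'(2) assms(1) by (auto intro!: sat_cong_free_vars)
  then show ?thesis using A'(1) by (simp add: \<psi>)
qed

text \<open>Totality of the restriction is a bounded statement, since the second coordinate is found
  in an element of the pair. It makes the internal star map defined on all of
  \<open>iter_univ E star n\<close>.\<close>

lemma ex_kpair_in_star_restrict:
  assumes "x \<in> elts E ((star ^^ n) B)"
  shows "\<exists>y. kpair E X x y \<in> elts E ((star ^^ n) (star_restrict E X star B))"
proof -
  let ?\<phi> = "FBAll 8 6 (FBEx 1 0 (FBEx 2 1 (FBEx 9 2 (pair_formula 1 8 9))))"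
  let ?A = "\<lambda>i. if i = 0 then star_restrict E X star B else B"
  have sat_iff: "sat E ?\<phi> A \<longleftrightarrow> (\<forall>x\<in>elts E (A 6). \<exists>p\<in>elts E (A 0). \<exists>u\<in>elts E p.
      \<exists>y\<in>elts E u. p = kpair E X x y)" for A
    by (simp add: sat_pair_formula)
  have "sat E ?\<phi> ?A"
    unfolding sat_iff by (simp add: elts_star_restrict) blast
  then have "sat E ?\<phi> (\<lambda>i. (star ^^ n) (?A i))"
    by (rule transfer_funpow[THEN iffD1])
  with assms show ?thesis unfolding sat_iff by auto
qed

text \<open>Finitely many sets have their elements in one level, which is itself the collection of
  elements of a set.\<close>

lemma ex_common_superset:
  assumes "finite I"
  shows "\<exists>C. \<forall>i\<in>I. elts E (B i) \<subseteq> elts E C"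
proof -
  have "\<forall>i. \<exists>j. elts E (B i) \<subseteq> vlevel E X j"
    by (metis obtain_elts_subset_vlevel)
  then obtain l where l: "\<And>i. elts E (B i) \<subseteq> vlevel E X (l i)" by metis
  \<comment> \<open>For empty \<open>I\<close> the value of \<open>Max\<close> is unspecified, but
    then nothing is claimed.\<close>
  define m where "m = Max (l ` I)"
  have "elts E (B i) \<subseteq> elts E (mkset E X (vlevel E X m))" if "i \<in> I" for i
    using l[of i] vlevel_mono[of "l i" m] assms that by (auto simp: m_def mkset(2)[OF order_refl])
  then show ?thesis by blast
qed

section \<open>The internal star map as a function\<close>

lemma internal_star_graph_single_valued:
  assumes "kpair E X x y \<in> internal_star_graph E X star n"
    and "kpair E X x z \<in> internal_star_graph E X star n"
  shows "y = z"
proof -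
  obtain B C where
    B: "kpair E X x y \<in> elts E ((star ^^ n) (star_restrict E X star B))" and
    C: "kpair E X x z \<in> elts E ((star ^^ n) (star_restrict E X star C))"
    using assms by (auto simp: internal_star_graph_def)
  obtain D where "elts E B \<subseteq> elts E D" "elts E C \<subseteq> elts E D"
    using ex_common_superset[of "{B, C}" id] by auto
  then have
    "kpair E X x y \<in> elts E ((star ^^ n) (star_restrict E X star D))"
    "kpair E X x z \<in> elts E ((star ^^ n) (star_restrict E X star D))"
    using B C funpow_star_mono star_restrict_mono by blast+
  \<comment> \<open>Both pairs have first coordinate \<open>x\<close>, so the left side is true; the
    right side reads \<open>y = z\<close>.\<close>
  then have "sat E (FEq 1 2) (\<lambda>_. x) \<longleftrightarrow> sat E (FEq 1 2) (\<lambda>i. if i = 1 then y else z)"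
    by (intro transfer_star_restrict[where k = 2 and n = n and B = D]) auto
  then show ?thesis by simp
qed

lemma internal_star_eq:
  assumes "kpair E X x y \<in> elts E ((star ^^ n) (star_restrict E X star B))"
  shows "internal_star E X star n x = y"
proof -
  have "kpair E X x y \<in> internal_star_graph E X star n"
    using assms by (auto simp: internal_star_graph_def)
  then show ?thesis
    unfolding internal_star_def using internal_star_graph_single_valued by blast
qed

end

theorem theorem3p7:
  fixes E :: "'v \<Rightarrow> 'v \<Rightarrow> bool" and X :: "'v set"
    and rl :: "real \<Rightarrow> 'v" and star :: "'v \<Rightarrow> 'v"
    and n k :: nat and \<sigma> :: bformula and \<xi> :: "nat \<Rightarrow> 'v"
  assumes "star_superstructure E X rl star"
    and "free_vars \<sigma> \<subseteq> {1..k}"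
    and "\<And>i. i \<in> {1..k} \<Longrightarrow> \<xi> i \<in> iter_univ E star n"
  shows "sat E \<sigma> \<xi> \<longleftrightarrow> sat E \<sigma> (\<lambda>i. internal_star E X star n (\<xi> i))"
proof -
  interpret star_superstructure E X rl star by fact
  obtain B where B: "\<And>i. i \<in> {1..k} \<Longrightarrow> \<xi> i \<in> elts E ((star ^^ n) (B i))"
    using assms(3) unfolding iter_univ_def by (simp add: Bex_def) metis
  \<comment> \<open>The transferred statement concerns a single restriction, so the finitely many
    \<open>B i\<close> are merged.\<close>
  obtain C where "\<forall>i\<in>{1..k}. elts E (B i) \<subseteq> elts E C"
    using ex_common_superset[of "{1..k}" B] by auto
  then have C: "\<xi> i \<in> elts E ((star ^^ n) C)" if "i \<in> {1..k}" for i
    using B funpow_star_mono that by blast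
  \<comment> \<open>Totality supplies a pair, and single-valuedness identifies its second
    coordinate.\<close>
  have "kpair E X (\<xi> i) (internal_star E X star n (\<xi> i))
      \<in> elts E ((star ^^ n) (star_restrict E X star C))" if "i \<in> {1..k}" for i
    using ex_kpair_in_star_restrict[OF C[OF that]] internal_star_eq by blast
  then show ?thesis by (rule transfer_star_restrict[OF assms(2)])
qed

end
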